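(* Let $H\in(0,1/2)$, $T>0$, and $g'\in L_2([0,T])$. Then there exists a unique function $x\in L_2([0,T])$ that satisfies $$x(t)+C_2\int_0^T\kappa(z,t)x(z)\,dz=g'(t)$$ for (almost) all $t\in[0,T]$. Consequently, the same is true for the equivalent equations $$C_1^{-2}t^{1/2-H}\left(I_{T^-}^{1/2-H}\left(\cdot^{2H-1}I_0^{1/2-H}(\cdot^{1/2-H}x)\right)\right)(t)+x(t)=g'(t)$$ and $$K_T^{H,*}\left(K_0^{H,*}x\right)(t)+x(t)=g'(t),\qquad t\in[0,T].$$
   Context: Riemann–Liouville fractional integrals of order $\alpha>0$ on $[0,T]$: $(I_0^\alpha\varphi)(t)=\frac1{\Gamma(\alpha)}\int_0^t(t-z)^{\alpha-1}\varphi(z)dz$ and $(I_{T^-}^\alpha\varphi)(t)=\frac1{\Gamma(\alpha)}\int_t^T(z-t)^{\alpha-1}\varphi(z)dz$. The dot denotes the integration variable. $C_1=\left(\frac{2H\Gamma(H+1/2)\Gamma(3/2-H)}{\Gamma(2-2H)}\right)^{1/2}$, $C_2=\frac{C_1^{-2}}{(\Gamma(1/2-H))^2}$. $(K^{H,*}_0\varphi)(t)=C_1^{-1}t^{H-1/2}\left(I_0^{1/2-H}(\cdot^{1/2-H}\varphi)\right)(t)$, $(K^{H,*}_T\varphi)(t)=C_1^{-1}t^{1/2-H}\left(I_{T^-}^{1/2-H}(\cdot^{H-1/2}\varphi)\right)(t)$. Kernel: $$\kappa(z,t)=(tz)^{1/2-H}\int_t^T(u-t)^{-1/2-H}u^{2H-1}(u-z)^{-1/2-H}du\,\mathbf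 1_{\{0\le z<t\le T\}}+(tz)^{1/2-H}\int_z^T(u-t)^{-1/2-H}u^{2H-1}(u-z)^{-1/2-H}du\,\mathbf 1_{\{0\le t<z\le T\}}.$$ Uniqueness is as an element of $L_2([0,T])$. *)

theory Defs
  imports "HOL-Analysis.Analysis"
begin

definition L2 :: "real \<Rightarrow> (real \<Rightarrow> real) set" where
  "L2 T = {f. f \<in> borel_measurable (lebesgue_on {0..T}) \<and>
              integrable (lebesgue_on {0..T}) (\<lambda>t. (f t)\<^sup>2)}"

text \<open>Functions represent elements of \<open>L\<^sub>2([0,T])\<close>, so uniqueness is up to null sets.\<close>

definition has_unique_L2_solution :: "real \<Rightarrow> ((real \<Rightarrow> real) \<Rightarrow> bool) \<Rightarrow> bool" where
  "has_unique_L2_solution T P \<longleftrightarrow>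
     (\<exists>x\<in>L2 T. P x \<and> (\<forall>y\<in>L2 T. P y \<longrightarrow> (AE t in lebesgue_on {0..T}. y t = x t)))"

text \<open>The Riemann--Liouville integrals are total functions, as is the Lebesgue integral. The
  predicates \<open>RL_left_exists\<close> and \<open>RL_right_exists\<close> say that the integral at the point \<open>t\<close>
  exists. The value \<open>0 powr a = 0\<close> for \<open>a < 0\<close> affects only null sets.\<close>

definition RL_left :: "real \<Rightarrow> (real \<Rightarrow> real) \<Rightarrow> real \<Rightarrow> real" where
  "RL_left \<alpha> \<phi> t = 1 / Gamma \<alpha> * (LINT z:{0..t}|lebesgue. (t - z) powr (\<alpha> - 1) * \<phi> z)"

definition RL_right :: "real \<Rightarrow> real \<Rightarrow> (real \<Rightarrow> real) \<Rightarrow> real \<Rightarrow> real" where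
  "RL_right T \<alpha> \<phi> t = 1 / Gamma \<alpha> * (LINT z:{t..T}|lebesgue. (z - t) powr (\<alpha> - 1) * \<phi> z)"

definition RL_left_exists :: "real \<Rightarrow> (real \<Rightarrow> real) \<Rightarrow> real \<Rightarrow> bool" where
  "RL_left_exists \<alpha> \<phi> t \<longleftrightarrow> set_integrable lebesgue {0..t} (\<lambda>z. (t - z) powr (\<alpha> - 1) * \<phi> z)"

definition RL_right_exists :: "real \<Rightarrow> real \<Rightarrow> (real \<Rightarrow> real) \<Rightarrow> real \<Rightarrow> bool" where
  "RL_right_exists T \<alpha> \<phi> t \<longleftrightarrow> set_integrable lebesgue {t..T} (\<lambda>z. (z - t) powr (\<alpha> - 1) * \<phi> z)"

definition C1 :: "real \<Rightarrow> real" where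
  "C1 H = (2 * H * Gamma (H + 1/2) * Gamma (3/2 - H) / Gamma (2 - 2 * H)) powr (1/2)"

definition C2 :: "real \<Rightarrow> real" where
  "C2 H = C1 H powi (-2) / (Gamma (1/2 - H))\<^sup>2"

definition K0_star :: "real \<Rightarrow> (real \<Rightarrow> real) \<Rightarrow> real \<Rightarrow> real" where
  "K0_star H \<phi> t =
     inverse (C1 H) * t powr (H - 1/2) * RL_left (1/2 - H) (\<lambda>z. z powr (1/2 - H) * \<phi> z) t"

definition KT_star :: "real \<Rightarrow> real \<Rightarrow> (real \<Rightarrow> real) \<Rightarrow> real \<Rightarrow> real" where
  "KT_star T H \<phi> t =
     inverse (C1 H) * t powr (1/2 - H) * RL_right T (1/2 - H) (\<lambda>z. z powr (H - 1/2) * \<phi> z) t"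

definition kappa_integrand :: "real \<Rightarrow> real \<Rightarrow> real \<Rightarrow> real \<Rightarrow> real" where
  "kappa_integrand H z t u =
     (u - t) powr (-1/2 - H) * u powr (2 * H - 1) * (u - z) powr (-1/2 - H)"

definition kappa :: "real \<Rightarrow> real \<Rightarrow> real \<Rightarrow> real \<Rightarrow> real" where
  "kappa H T z t =
     (t * z) powr (1/2 - H) * (LINT u:{t..T}|lebesgue. kappa_integrand H z t u)
       * of_bool (0 \<le> z \<and> z < t \<and> t \<le> T)
   + (t * z) powr (1/2 - H) * (LINT u:{z..T}|lebesgue. kappa_integrand H z t u)
       * of_bool (0 \<le> t \<and> t < z \<and> z \<le> T)"

definition solves_kernel_eq :: "real \<Rightarrow> real \<Rightarrow> (real \<Rightarrow> real) \<Rightarrow> (real \<Rightarrow> real) \<Rightarrow> bool" where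
  "solves_kernel_eq H T g x \<longleftrightarrow>
     (AE t in lebesgue_on {0..T}.
        x t + C2 H * (LINT z:{0..T}|lebesgue. kappa H T z t * x z) = g t)"

definition solves_RL_eq :: "real \<Rightarrow> real \<Rightarrow> (real \<Rightarrow> real) \<Rightarrow> (real \<Rightarrow> real) \<Rightarrow> bool" where
  "solves_RL_eq H T g x \<longleftrightarrow>
     (AE t in lebesgue_on {0..T}.
        C1 H powi (-2) * t powr (1/2 - H)
          * RL_right T (1/2 - H)
              (\<lambda>u. u powr (2 * H - 1) * RL_left (1/2 - H) (\<lambda>z. z powr (1/2 - H) * x z) u) t
        + x t = g t)"

definition solves_K_eq :: "real \<Rightarrow> real \<Rightarrow> (real \<Rightarrow> real) \<Rightarrow> (real \<Rightarrow> real) \<Rightarrow> bool" where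
  "solves_K_eq H T g x \<longleftrightarrow>
     (AE t in lebesgue_on {0..T}. KT_star T H (K0_star H x) t + x t = g t)"

text \<open>All integrals in the three equations exist; without this, an equation could hold or fail
  because a divergent integral is assigned the value \<open>0\<close>.\<close>

definition integrals_exist :: "real \<Rightarrow> real \<Rightarrow> (real \<Rightarrow> real) \<Rightarrow> bool" where
  "integrals_exist H T x \<longleftrightarrow>
     (\<forall>z\<in>{0..T}. \<forall>t\<in>{0..T}. z \<noteq> t \<longrightarrow>
        set_integrable lebesgue {max z t..T} (kappa_integrand H z t)) \<and>
     (AE t in lebesgue_on {0..T}. set_integrable lebesgue {0..T} (\<lambda>z. kappa H T z t * x z)) \<and>
     (AE t in lebesgue_on {0..T}. RL_left_exists (1/2 - H) (\<lambda>z. z powr (1/2 - H) * x z) t) \<and>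
     (AE t in lebesgue_on {0..T}. RL_right_exists T (1/2 - H)
        (\<lambda>u. u powr (2 * H - 1) * RL_left (1/2 - H) (\<lambda>z. z powr (1/2 - H) * x z) u) t) \<and>
     (AE t in lebesgue_on {0..T}. RL_right_exists T (1/2 - H)
        (\<lambda>u. u powr (H - 1/2) * K0_star H x u) t)"

end

theory Submission
  imports Defs
begin

text \<open>Put \<open>\<alpha> = 1/2 - H\<close>. On \<open>[0,T]\<close> the operator \<open>K\<^sub>0\<^sup>*\<close> has, up to a constant, the kernel
  \<open>k t z = t\<^sup>-\<^sup>\<alpha> (t - z)\<^sup>\<alpha>\<^sup>-\<^sup>1 z\<^sup>\<alpha>\<close> for \<open>z \<le> t\<close>, which is dominated by the convolution kernel
  \<open>(t - z)\<^sup>\<alpha>\<^sup>-\<^sup>1\<close>. Hence \<open>K\<^sub>0\<^sup>*\<close> is bounded on \<open>L\<^sub>2\<close>, and \<open>K\<^sub>T\<^sup>*\<close> is its adjoint, with the transposed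
  kernel. By Fubini all three equations read \<open>x + B x = g\<close> with the same bounded positive operator
  \<open>B = K\<^sub>T\<^sup>* K\<^sub>0\<^sup>*\<close>. Positivity gives uniqueness, and makes the relaxed iteration
  \<open>x \<mapsto> x - \<epsilon> (x + B x - g)\<close> a contraction for small \<open>\<epsilon>\<close>, which gives existence.\<close>

subsection \<open>Bounded positive operators on \<open>L\<^sub>2\<close>\<close>

definition square_integrable :: "'a measure \<Rightarrow> ('a \<Rightarrow> real) \<Rightarrow> bool" where
  "square_integrable M f \<longleftrightarrow> f \<in> borel_measurable M \<and> integrable M (\<lambda>t. (f t)\<^sup>2)"

lemma square_integrable_measurable:
  "square_integrable M f \<Longrightarrow> f \<in> borel_measurable M"
  by (simp add: square_integrable_def)

lemma square_integrable_power2: "square_integrable M f \<Longrightarrow> integrable M (\<lambda>t. (f t)\<^sup>2)"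
  by (simp add: square_integrable_def)

lemma abs_mult_le_sum_squares: "\<bar>a * b\<bar> \<le> a\<^sup>2 + (b::real)\<^sup>2"
proof -
  have "0 \<le> (\<bar>a\<bar> - \<bar>b\<bar>)\<^sup>2" by simp
  then have "2 * \<bar>a * b\<bar> \<le> a\<^sup>2 + b\<^sup>2" by (simp add: power2_diff abs_mult)
  then show ?thesis by (smt (verit) abs_ge_zero)
qed

lemma square_integrable_mult:
  assumes "square_integrable M f" "square_integrable M g"
  shows "integrable M (\<lambda>t. f t * g t)"
proof (rule Bochner_Integration.integrable_bound)
  show "integrable M (\<lambda>t. (f t)\<^sup>2 + (g t)\<^sup>2)"
    using assms by (simp add: square_integrable_power2)
  show "(\<lambda>t. f t * g t) \<in> borel_measurable M"
    using assms[THEN square_integrable_measurable] by measurable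
qed (use abs_mult_le_sum_squares in \<open>auto intro!: AE_I2\<close>)

lemma square_integrable_add_scaled:
  assumes "square_integrable M f" "square_integrable M g"
  shows "square_integrable M (\<lambda>t. a * f t + b * g t)"
proof -
  note [measurable] = assms[THEN square_integrable_measurable]
  have "integrable M (\<lambda>t. a\<^sup>2 * (f t)\<^sup>2 + 2 * a * b * (f t * g t) + b\<^sup>2 * (g t)\<^sup>2)"
    using assms by (intro Bochner_Integration.integrable_add integrable_mult_right square_integrable_mult)
      (auto simp: square_integrable_power2)
  then have "integrable M (\<lambda>t. (a * f t + b * g t)\<^sup>2)"
    by (simp add: power2_sum power_mult_distrib algebra_simps)
  then show ?thesis unfolding square_integrable_def by simp
qed

lemma square_integrable_add:
  "square_integrable M f \<Longrightarrow> square_integrable M g \<Longrightarrow> square_integrable M (\<lambda>t. f t + g t)"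
  using square_integrable_add_scaled[of M f g 1 1] by simp

lemma square_integrable_diff:
  "square_integrable M f \<Longrightarrow> square_integrable M g \<Longrightarrow> square_integrable M (\<lambda>t. f t - g t)"
  using square_integrable_add_scaled[of M f g 1 "-1"] by simp

lemma square_integrable_cmult:
  "square_integrable M f \<Longrightarrow> square_integrable M (\<lambda>t. a * f t)"
  using square_integrable_add_scaled[of M f f a 0] by simp

lemma square_integrable_sum:
  "(\<And>i. square_integrable M (f i)) \<Longrightarrow> square_integrable M (\<lambda>t. \<Sum>i<n. f i t)" for n :: nat
proof (induction n)
  case 0
  then show ?case by (simp add: square_integrable_def)
next
  case (Suc n)
  then show ?case by (simp add: square_integrable_add)
qed

lemma square_integrable_abs: "square_integrable M f \<Longrightarrow> square_integrable M (\<lambda>t. \<bar>f t\<bar>)"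
  by (auto simp: square_integrable_def)

text \<open>With \<open>r = sqrt q\<close> the function \<open>S = (\<Sum>k. d\<^sub>k\<^sup>2 / r\<^sup>k)\<close> is integrable, and \<open>\<bar>d\<^sub>k\<bar> \<le> sqrt (S r\<^sup>k)\<close>
  gives pointwise convergence together with an integrable bound for the squared tails.\<close>

lemma square_integrable_series:
  fixes d :: "nat \<Rightarrow> 'a \<Rightarrow> real"
  assumes d: "\<And>n. square_integrable M (d n)"
    and le: "\<And>n. (\<integral>t. (d n t)\<^sup>2 \<partial>M) \<le> C * q ^ n" and q: "0 < q" "q < 1"
  obtains x where "square_integrable M x"
    "(\<lambda>n. \<integral>t. (x t - (\<Sum>k<n. d k t))\<^sup>2 \<partial>M) \<longlonglongrightarrow> 0"
proof -
  have [measurable]: "\<And>n. d n \<in> borel_measurable M" using d by (rule square_integrable_measurable)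
  define r where "r = sqrt q"
  \<comment> \<open>In q^k = r^k r^k one factor pays for the division in \<open>f\<close> and the
    other makes the integrals of \<open>f k\<close> summable. What is left for \<open>d k\<close>
    itself is the rate \<open>s\<close>: its absolute value is at most sqrt (S t) * s^k.\<close>
  define s where "s = sqrt r"
  have r: "0 < r" "r < 1" "q = r * r" using q by (auto simp: r_def)
  have s: "0 < s" "s < 1" "s * s = r" using r by (auto simp: s_def)
  define f where "f k t = (d k t)\<^sup>2 / r ^ k" for k t
  define S where "S t = (\<Sum>k. f k t)" for t
  have f0: "0 \<le> f k t" for k t using r by (simp add: f_def)
  have f_int: "integrable M (f k)" for k
    using d unfolding f_def by (intro integrable_divide square_integrable_power2)
  have fle: "(\<integral>t. f k t \<partial>M) \<le> C * r ^ k" for k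
  proof -
    have "(\<integral>t. f k t \<partial>M) = (\<integral>t. (d k t)\<^sup>2 \<partial>M) / r ^ k" by (simp add: f_def)
    also have "\<dots> \<le> C * q ^ k / r ^ k" using le r by (intro divide_right_mono) auto
    also have "\<dots> = C * r ^ k" using r by (simp add: power_mult_distrib)
    finally show ?thesis .
  qed
  have sum_int: "summable (\<lambda>k. \<integral>t. f k t \<partial>M)"
  proof (rule summable_comparison_test')
    show "summable (\<lambda>k. C * r ^ k)" using r by (intro summable_mult summable_geometric) auto
    show "norm (\<integral>t. f k t \<partial>M) \<le> C * r ^ k" for k
      using fle[of k] f0 by (simp add: integral_nonneg_AE)
  qed
  have "(\<integral>\<^sup>+t. (\<Sum>k. ennreal (f k t)) \<partial>M) = (\<Sum>k. \<integral>\<^sup>+t. f k t \<partial>M)"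
    by (rule nn_integral_suminf) (simp add: f_def)
  also have "\<dots> = (\<Sum>k. ennreal (\<integral>t. f k t \<partial>M))"
    using f_int f0 by (simp add: nn_integral_eq_integral)
  also have "\<dots> = ennreal (\<Sum>k. \<integral>t. f k t \<partial>M)"
    using sum_int f0 by (intro suminf_ennreal2) (auto simp: integral_nonneg_AE)
  finally have fin: "(\<integral>\<^sup>+t. (\<Sum>k. ennreal (f k t)) \<partial>M) \<noteq> \<infinity>" by simp
  \<comment> \<open>Working in \<open>ennreal\<close> presupposes no convergence: the sum has a
    finite integral, hence is finite almost everywhere, and there the real series converges.\<close>
  have "AE t in M. (\<Sum>k. ennreal (f k t)) \<noteq> \<infinity>"
    by (rule nn_integral_PInf_AE[OF _ fin]) (simp add: f_def)
  then have summ: "AE t in M. summable (\<lambda>k. f k t)"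
    by eventually_elim (use f0 in \<open>auto intro: summable_suminf_not_top\<close>)
  have S_int: "integrable M S"
    unfolding S_def[abs_def] using f_int summ sum_int f0 by (intro integrable_suminf) auto
  \<comment> \<open>On the null set where this series diverges \<open>x\<close> has an unspecified
    value; it is measurable all the same.\<close>
  define x where "x t = (\<Sum>k. d k t)" for t
  have [measurable]: "x \<in> borel_measurable M" unfolding x_def[abs_def] by measurable
  \<comment> \<open>One estimate serves twice: n = 0 dominates x^2 by a multiple of
    \<open>S\<close>, and general \<open>n\<close> drives the squared tails to 0.\<close>
  have bound: "AE t in M. (x t - (\<Sum>k<n. d k t))\<^sup>2 \<le> r ^ n / (1 - s)\<^sup>2 * S t" for n
    using summ
  proof eventually_elim
    case (elim t)
    have S0: "0 \<le> S t" unfolding S_def using elim f0 by (rule suminf_nonneg)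
    have dk: "\<bar>d k t\<bar> \<le> sqrt (S t) * s ^ k" for k
    proof -
      have "f k t \<le> S t"
        unfolding S_def using sum_le_suminf[OF elim, of "{k}"] f0 by simp
      then have "(d k t)\<^sup>2 \<le> S t * r ^ k" using r by (simp add: f_def field_simps)
      then have "sqrt ((d k t)\<^sup>2) \<le> sqrt (S t * r ^ k)" by (rule real_sqrt_le_mono)
      then show ?thesis unfolding real_sqrt_abs real_sqrt_mult by (simp add: real_sqrt_power s_def)
    qed
    have geo: "summable (\<lambda>k. s ^ k)" using s by (intro summable_geometric) auto
    have ds: "summable (\<lambda>k. d k t)"
      by (rule summable_comparison_test'[OF summable_mult[OF geo, of "sqrt (S t)"]]) (use dk in simp)
    have "x t - (\<Sum>k<n. d k t) = (\<Sum>k. d (k + n) t)"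
      unfolding x_def using suminf_split_initial_segment[OF ds, of n] by simp
    also have "\<bar>\<dots>\<bar> \<le> (\<Sum>k. sqrt (S t) * s ^ n * s ^ k)"
    proof -
      have sm: "summable (\<lambda>k. sqrt (S t) * s ^ n * s ^ k)" using geo by (rule summable_mult)
      have b: "\<bar>d (k + n) t\<bar> \<le> sqrt (S t) * s ^ n * s ^ k" for k
        using dk[of "k + n"] by (simp add: power_add mult_ac)
      have sa: "summable (\<lambda>k. \<bar>d (k + n) t\<bar>)"
        by (rule summable_comparison_test'[OF sm]) (use b in simp)
      show ?thesis using summable_rabs[OF sa] suminf_le[OF b sa sm] by linarith
    qed
    also have "\<dots> = sqrt (S t) * s ^ n / (1 - s)"
      using s geo by (simp add: suminf_mult suminf_geometric)
    finally have "\<bar>x t - (\<Sum>k<n. d k t)\<bar>\<^sup>2 \<le> (sqrt (S t) * s ^ n / (1 - s))\<^sup>2"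
      by (rule power_mono) simp
    also have "\<dots> = r ^ n / (1 - s)\<^sup>2 * S t"
      using S0 by (simp add: power_divide power_mult_distrib s(3)[symmetric] power2_eq_square[of "s ^ n"])
    finally show ?case by simp
  qed
  have part: "square_integrable M (\<lambda>t. \<Sum>k<n. d k t)" for n
    using d by (rule square_integrable_sum)
  have "integrable M (\<lambda>t. (x t)\<^sup>2)"
  proof (rule Bochner_Integration.integrable_bound)
    show "integrable M (\<lambda>t. r ^ 0 / (1 - s)\<^sup>2 * S t)" using S_int by (rule integrable_mult_right)
    show "AE t in M. norm ((x t)\<^sup>2) \<le> norm (r ^ 0 / (1 - s)\<^sup>2 * S t)"
      using bound[of 0]
    proof eventually_elim
      case (elim t)
      then show ?case by (simp add: order_trans[OF _ abs_ge_self] del: abs_divide)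
    qed
  qed measurable
  then have x: "square_integrable M x" by (simp add: square_integrable_def)
  moreover have "(\<lambda>n. \<integral>t. (x t - (\<Sum>k<n. d k t))\<^sup>2 \<partial>M) \<longlonglongrightarrow> 0"
  proof (rule tendsto_sandwich[where f = "\<lambda>_. 0"])
    show "\<forall>\<^sub>F n in sequentially. (\<integral>t. (x t - (\<Sum>k<n. d k t))\<^sup>2 \<partial>M) \<le> r ^ n / (1 - s)\<^sup>2 * (\<integral>t. S t \<partial>M)"
    proof (rule always_eventually, rule allI)
      fix n
      have "(\<integral>t. (x t - (\<Sum>k<n. d k t))\<^sup>2 \<partial>M) \<le> (\<integral>t. r ^ n / (1 - s)\<^sup>2 * S t \<partial>M)"
        by (rule integral_mono_AE[OF _ _ bound])
          (use square_integrable_power2[OF square_integrable_diff[OF x part]] S_int in auto)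
      then show "(\<integral>t. (x t - (\<Sum>k<n. d k t))\<^sup>2 \<partial>M) \<le> r ^ n / (1 - s)\<^sup>2 * (\<integral>t. S t \<partial>M)" by simp
    qed
    have "(\<lambda>n. r ^ n * (1 / (1 - s)\<^sup>2 * (\<integral>t. S t \<partial>M))) \<longlonglongrightarrow> 0 * (1 / (1 - s)\<^sup>2 * (\<integral>t. S t \<partial>M))"
      using r by (intro tendsto_mult_right LIMSEQ_realpow_zero) auto
    then show "(\<lambda>n. r ^ n / (1 - s)\<^sup>2 * (\<integral>t. S t \<partial>M)) \<longlonglongrightarrow> 0" by simp
  qed (auto intro!: always_eventually integral_nonneg_AE)
  ultimately show ?thesis by (rule that)
qed

section \<open>The equation x + B x = g for a bounded positive operator\<close>

lemma integral_power2_sum_le: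
  assumes "square_integrable M f" "square_integrable M g"
  shows "(\<integral>t. (f t + g t)\<^sup>2 \<partial>M) \<le> 2 * (\<integral>t. (f t)\<^sup>2 \<partial>M) + 2 * (\<integral>t. (g t)\<^sup>2 \<partial>M)"
proof -
  have "(\<integral>t. (f t + g t)\<^sup>2 \<partial>M) \<le> (\<integral>t. 2 * (f t)\<^sup>2 + 2 * (g t)\<^sup>2 \<partial>M)"
  proof (rule integral_mono)
    show "(f t + g t)\<^sup>2 \<le> 2 * (f t)\<^sup>2 + 2 * (g t)\<^sup>2" for t
      using zero_le_power2[of "f t - g t"] by (simp add: power2_sum power2_diff)
  qed (use assms in \<open>auto intro!: square_integrable_power2 square_integrable_add\<close>)
  also have "\<dots> = 2 * (\<integral>t. (f t)\<^sup>2 \<partial>M) + 2 * (\<integral>t. (g t)\<^sup>2 \<partial>M)"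
    using assms by (simp add: square_integrable_power2)
  finally show ?thesis .
qed

text \<open>Functions stand for their classes modulo null sets, so the operator \<open>B\<close> need only be linear
  almost everywhere.\<close>

locale positive_L2_operator =
  fixes M :: "'a measure" and B :: "('a \<Rightarrow> real) \<Rightarrow> 'a \<Rightarrow> real" and C :: real
  assumes closed: "square_integrable M x \<Longrightarrow> square_integrable M (B x)"
    and linear: "square_integrable M x \<Longrightarrow> square_integrable M y \<Longrightarrow>
      AE t in M. B (\<lambda>s. a * x s + b * y s) t = a * B x t + b * B y t"
    and bounded: "square_integrable M x \<Longrightarrow> (\<integral>t. (B x t)\<^sup>2 \<partial>M) \<le> C * (\<integral>t. (x t)\<^sup>2 \<partial>M)"
    and positive: "square_integrable M x \<Longrightarrow> 0 \<le> (\<integral>t. x t * B x t \<partial>M)"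
    and C_pos: "0 < C"
begin

text \<open>The difference \<open>d\<close> of two solutions satisfies B d = -d, so the integral of
  d * B d is minus that of d^2. Positivity then forces d = 0 almost everywhere.\<close>

lemma solution_unique:
  assumes x: "square_integrable M x" and y: "square_integrable M y"
    and "AE t in M. x t + B x t = g t" "AE t in M. y t + B y t = g t"
  shows "AE t in M. y t = x t"
proof -
  \<comment> \<open>The coefficients 1 and -1 are spelled out so that the instance of
    \<open>linear\<close> folds into \<open>d\<close>.\<close>
  define d where "d = (\<lambda>t. 1 * y t + (-1) * x t)"
  have d: "square_integrable M d" unfolding d_def using y x by (rule square_integrable_add_scaled)
  have "AE t in M. d t * B d t = - (d t)\<^sup>2"
    using linear[OF y x, of 1 "-1", folded d_def] assms(3,4)
  proof eventually_elim
    case (elim t)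
    then have "B d t = - d t" by (simp add: d_def)
    then show ?case by (simp add: power2_eq_square)
  qed
  then have "(\<integral>t. d t * B d t \<partial>M) = (\<integral>t. - (d t)\<^sup>2 \<partial>M)"
    using d[THEN square_integrable_measurable] closed[OF d, THEN square_integrable_measurable]
    by (intro integral_cong_AE) auto
  with positive[OF d] have "(\<integral>t. (d t)\<^sup>2 \<partial>M) \<le> 0" by simp
  moreover have "0 \<le> (\<integral>t. (d t)\<^sup>2 \<partial>M)" by simp
  ultimately have "(\<integral>t. (d t)\<^sup>2 \<partial>M) = 0" by linarith
  then have "AE t in M. (d t)\<^sup>2 = 0"
    using d by (subst integral_nonneg_eq_0_iff_AE[symmetric]) (auto simp: square_integrable_power2)
  then show ?thesis by eventually_elim (simp add: d_def)
qed

text \<open>With \<open>\<epsilon> = 1 / (1 + C)\<close> the relaxed iteration \<open>x \<mapsto> x - \<epsilon> (x + B x - g)\<close> contracts the squared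
  residual by the factor \<open>1 - \<epsilon>\<close>.\<close>

lemma relaxation_contracts:
  assumes x: "square_integrable M x" and e: "e = 1 / (1 + C)"
  shows "(\<integral>t. (x t - e * (x t + B x t))\<^sup>2 \<partial>M) \<le> (1 - e) * (\<integral>t. (x t)\<^sup>2 \<partial>M)"
proof -
  note [intro] = square_integrable_power2 square_integrable_mult closed
  have e01: "0 < e" "e \<le> 1" "e * (1 + C) = 1" using C_pos by (auto simp: e field_simps)
  let ?X = "\<integral>t. (x t)\<^sup>2 \<partial>M" and ?P = "\<integral>t. x t * B x t \<partial>M"
  have "(\<integral>t. (x t - e * (x t + B x t))\<^sup>2 \<partial>M)
      = (\<integral>t. (1 - e)\<^sup>2 * (x t)\<^sup>2 - 2 * (1 - e) * e * (x t * B x t) + e\<^sup>2 * (B x t)\<^sup>2 \<partial>M)"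
    by (rule Bochner_Integration.integral_cong) (auto simp: power2_eq_square algebra_simps)
  also have "\<dots> = (1 - e)\<^sup>2 * ?X - 2 * (1 - e) * e * ?P + e\<^sup>2 * (\<integral>t. (B x t)\<^sup>2 \<partial>M)"
  proof -
    have i: "integrable M (\<lambda>t. (1 - e)\<^sup>2 * (x t)\<^sup>2)" "integrable M (\<lambda>t. 2 * (1 - e) * e * (x t * B x t))"
      "integrable M (\<lambda>t. e\<^sup>2 * (B x t)\<^sup>2)"
      using x by (auto simp del: integrable_mult_right_iff intro!: integrable_mult_right)
    show ?thesis
      by (simp only: Bochner_Integration.integral_add[OF Bochner_Integration.integrable_diff[OF i(1,2)] i(3)]
        Bochner_Integration.integral_diff[OF i(1,2)] integral_mult_right_zero)
  qed
  \<comment> \<open>Positivity disposes of the cross term. The choice of \<open>e\<close> minimizes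
    the remaining factor (1 - e)^2 + e^2 C, whose value is then 1 - e.\<close>
  also have "\<dots> \<le> (1 - e)\<^sup>2 * ?X - 0 + e\<^sup>2 * (C * ?X)"
    using positive[OF x] bounded[OF x] e01
    by (intro add_mono diff_mono mult_left_mono mult_nonneg_nonneg) auto
  also have "\<dots> = (1 - 2 * e + e * (e * (1 + C))) * ?X"
    by (simp add: power2_eq_square algebra_simps)
  also have "\<dots> = (1 - e) * ?X" by (simp add: e01)
  finally show ?thesis .
qed

text \<open>The residuals \<open>R n\<close> of the iterates decay geometrically, and the increments
  of \<open>X\<close> are multiples of them, so \<open>square_integrable_series\<close> supplies a
  limit \<open>x\<close>. Boundedness of \<open>B\<close> carries the decay over to the residual
  \<open>E\<close> of \<open>x\<close>.\<close>

lemma solution_exists: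
  assumes g: "square_integrable M g"
  obtains x where "square_integrable M x" "AE t in M. x t + B x t = g t"
proof -
  note [intro] = square_integrable_power2 square_integrable_add square_integrable_diff
    square_integrable_cmult closed
  define e where "e = 1 / (1 + C)"
  define q where "q = 1 - e"
  \<comment> \<open>\<open>C_pos\<close> makes \<open>q\<close> positive, as the series lemma
    demands.\<close>
  have e: "0 < e" and q: "0 < q" "q < 1" using C_pos by (auto simp: e_def q_def field_simps)
  define X where "X = rec_nat (\<lambda>_. 0) (\<lambda>n x t. 1 * x t + (- e) * (x t + B x t - g t))"
  define R where "R n t = X n t + B (X n) t - g t" for n t
  have X_0: "X 0 = (\<lambda>_. 0)" and X_Suc: "X (Suc n) = (\<lambda>t. 1 * X n t + (- e) * R n t)" for n
    by (simp_all add: X_def R_def[abs_def])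
  have R_sq: "square_integrable M (R n)" if "square_integrable M (X n)" for n
    unfolding R_def[abs_def] using that g
    by (intro square_integrable_diff square_integrable_add closed)
  have X: "square_integrable M (X n)" for n
  proof (induction n)
    case 0
    then show ?case by (simp add: X_0 square_integrable_def)
  next
    case (Suc n)
    then show ?case unfolding X_Suc by (intro square_integrable_add_scaled R_sq)
  qed
  note R = R_sq[OF X]
  have R_step: "(\<integral>t. (R (Suc n) t)\<^sup>2 \<partial>M) \<le> q * (\<integral>t. (R n t)\<^sup>2 \<partial>M)" for n
  proof -
    \<comment> \<open>The term \<open>g\<close> cancels: residuals follow the homogeneous iteration,
      to which \<open>relaxation_contracts\<close> applies.\<close>
    have "AE t in M. R (Suc n) t = R n t - e * (R n t + B (R n) t)"
      using linear[OF X R, of 1 n "- e" n, folded X_Suc]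
    proof eventually_elim
      case (elim t)
      then show ?case unfolding R_def[of "Suc n"] by (simp add: X_Suc) (simp add: R_def algebra_simps)
    qed
    then have "(\<integral>t. (R (Suc n) t)\<^sup>2 \<partial>M) = (\<integral>t. (R n t - e * (R n t + B (R n) t))\<^sup>2 \<partial>M)"
      using R[of n, THEN square_integrable_measurable] R[of "Suc n", THEN square_integrable_measurable]
        closed[OF R, of n, THEN square_integrable_measurable]
      by (intro integral_cong_AE) (measurable, auto)
    also have "\<dots> \<le> q * (\<integral>t. (R n t)\<^sup>2 \<partial>M)"
      unfolding q_def using R e_def by (rule relaxation_contracts)
    finally show ?thesis .
  qed
  define A where "A = (\<integral>t. (R 0 t)\<^sup>2 \<partial>M)"
  have R_le: "(\<integral>t. (R n t)\<^sup>2 \<partial>M) \<le> A * q ^ n" for n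
  proof (induction n)
    case (Suc n)
    have "(\<integral>t. (R (Suc n) t)\<^sup>2 \<partial>M) \<le> q * (\<integral>t. (R n t)\<^sup>2 \<partial>M)" by (rule R_step)
    also have "\<dots> \<le> q * (A * q ^ n)" using Suc q by (intro mult_left_mono) auto
    finally show ?case by (simp add: mult_ac)
  qed (simp add: A_def)
  define d where "d n t = (- e) * R n t" for n t
  have X_sum: "X n t = (\<Sum>k<n. d k t)" for n t
    by (induction n) (simp_all add: X_0 X_Suc d_def)
  have d: "square_integrable M (d n)" for n
    unfolding d_def[abs_def] using R by (rule square_integrable_cmult)
  have d_le: "(\<integral>t. (d n t)\<^sup>2 \<partial>M) \<le> (e\<^sup>2 * A) * q ^ n" for n
  proof -
    have "(\<integral>t. (d n t)\<^sup>2 \<partial>M) = e\<^sup>2 * (\<integral>t. (R n t)\<^sup>2 \<partial>M)"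
      by (simp add: d_def power_mult_distrib)
    also have "\<dots> \<le> e\<^sup>2 * (A * q ^ n)" using R_le by (intro mult_left_mono) auto
    finally show ?thesis by simp
  qed
  obtain x where x: "square_integrable M x"
    and lim: "(\<lambda>n. \<integral>t. (x t - (\<Sum>k<n. d k t))\<^sup>2 \<partial>M) \<longlonglongrightarrow> 0"
    using square_integrable_series[OF d d_le q] by blast
  define D where "D n = (\<lambda>t. 1 * x t + (-1) * X n t)" for n
  have D: "square_integrable M (D n)" for n
    unfolding D_def using x X by (rule square_integrable_add_scaled)
  have D_lim: "(\<lambda>n. \<integral>t. (D n t)\<^sup>2 \<partial>M) \<longlonglongrightarrow> 0"
    using lim by (simp add: D_def X_sum)
  define E where "E t = x t + B x t - g t" for t
  have E: "square_integrable M E" unfolding E_def[abs_def] using x g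
    by (intro square_integrable_diff square_integrable_add closed)
  \<comment> \<open>Here E = R n + (D n + B (D n)). Each of the two splittings of a squared sum
    costs a factor 2, and \<open>bounded\<close> turns B (D n) into C times D n, which gives 2 * 2 *
    (1 + C). The left side is free of \<open>n\<close> while the right side tends to 0.\<close>
  have E_le: "(\<integral>t. (E t)\<^sup>2 \<partial>M) \<le> 2 * (A * q ^ n) + (4 + 4 * C) * (\<integral>t. (D n t)\<^sup>2 \<partial>M)" for n
  proof -
    have "AE t in M. E t = R n t + (D n t + B (D n) t)"
      using linear[OF x X, of 1 "-1" n, folded D_def]
      by eventually_elim (simp add: E_def R_def, simp add: D_def)
    then have "(\<integral>t. (E t)\<^sup>2 \<partial>M) = (\<integral>t. (R n t + (D n t + B (D n) t))\<^sup>2 \<partial>M)"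
      using E[THEN square_integrable_measurable] R[of n, THEN square_integrable_measurable]
        D[of n, THEN square_integrable_measurable] closed[OF D, of n, THEN square_integrable_measurable]
      by (intro integral_cong_AE) (measurable, auto)
    also have "\<dots> \<le> 2 * (\<integral>t. (R n t)\<^sup>2 \<partial>M) + 2 * (\<integral>t. (D n t + B (D n) t)\<^sup>2 \<partial>M)"
      using R D by (intro integral_power2_sum_le) auto
    also have "(\<integral>t. (D n t + B (D n) t)\<^sup>2 \<partial>M) \<le> 2 * (\<integral>t. (D n t)\<^sup>2 \<partial>M) + 2 * (\<integral>t. (B (D n) t)\<^sup>2 \<partial>M)"
      using D by (intro integral_power2_sum_le) auto
    finally show ?thesis using R_le[of n] bounded[OF D, of n] by (simp add: algebra_simps)
  qed
  have "(\<lambda>n. 2 * (A * q ^ n) + (4 + 4 * C) * (\<integral>t. (D n t)\<^sup>2 \<partial>M)) \<longlonglongrightarrow> 2 * (A * 0) + (4 + 4 * C) * 0"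
    using q D_lim by (intro tendsto_intros LIMSEQ_realpow_zero) auto
  then have "(\<integral>t. (E t)\<^sup>2 \<partial>M) \<le> 2 * (A * 0) + (4 + 4 * C) * 0"
    by (rule LIMSEQ_le_const) (use E_le in auto)
  moreover have "0 \<le> (\<integral>t. (E t)\<^sup>2 \<partial>M)" by simp
  ultimately have "(\<integral>t. (E t)\<^sup>2 \<partial>M) = 0" by linarith
  then have "AE t in M. (E t)\<^sup>2 = 0"
    using E by (subst integral_nonneg_eq_0_iff_AE[symmetric]) auto
  then have "AE t in M. x t + B x t = g t" by eventually_elim (simp add: E_def)
  with x show ?thesis by (rule that)
qed

end

subsection \<open>Integral operators with a Schur bound\<close>

definition kernel_op :: "'a measure \<Rightarrow> ('a \<Rightarrow> 'a \<Rightarrow> real) \<Rightarrow> ('a \<Rightarrow> real) \<Rightarrow> 'a \<Rightarrow> real" where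
  "kernel_op M k x t = (\<integral>z. k t z * x z \<partial>M)"

text \<open>True at every point, unlike additivity: where the integral diverges both sides are
  0.\<close>

lemma kernel_op_cmult: "kernel_op N k (\<lambda>z. c * x z) t = c * kernel_op N k x t"
  unfolding kernel_op_def by (simp flip: integral_mult_right_zero add: mult.left_commute[of c])

text \<open>Rows and columns share one constant \<open>S\<close>, so the transposed kernel satisfies
  the same assumptions and every fact about \<open>k\<close> also holds for the adjoint. Bounding
  \<open>nn_integral\<close> makes integrability of the rows a consequence.\<close>

locale schur_kernel = sigma_finite_measure M for M :: "'a measure" +
  fixes k :: "'a \<Rightarrow> 'a \<Rightarrow> real" and S :: real
  assumes kernel_measurable [measurable]: "case_prod k \<in> borel_measurable (M \<Otimes>\<^sub>M M)"
    and nonneg: "0 \<le> k t z"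
    and row: "t \<in> space M \<Longrightarrow> (\<integral>\<^sup>+z. k t z \<partial>M) \<le> ennreal S"
    and col: "z \<in> space M \<Longrightarrow> (\<integral>\<^sup>+t. k t z \<partial>M) \<le> ennreal S"
    and S_pos: "0 < S"
begin

sublocale P: pair_sigma_finite M M ..

lemma transpose: "schur_kernel M (\<lambda>t z. k z t) S"
proof
  show "(\<lambda>(t, z). k z t) \<in> borel_measurable (M \<Otimes>\<^sub>M M)" by measurable
qed (auto simp: nonneg row col S_pos)

lemma row_integrable:
  assumes t: "t \<in> space M"
  shows "integrable M (k t)" and "(\<integral>z. k t z \<partial>M) \<le> S"
proof -
  have [measurable]: "k t \<in> borel_measurable M" using t by measurable
  show int: "integrable M (k t)"
    using row[OF t] nonneg by (intro integrableI_bounded) (auto simp: less_top[symmetric] top_unique)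
  have "ennreal (\<integral>z. k t z \<partial>M) \<le> ennreal S"
    using row[OF t] nn_integral_eq_integral[OF int] nonneg by simp
  then show "(\<integral>z. k t z \<partial>M) \<le> S" using S_pos by (simp add: ennreal_le_iff)
qed

text \<open>By Tonelli, integrating over \<open>t\<close> first leaves at most \<open>S\<close>
  times the integral of the absolute value of \<open>f\<close>. The main instance is f =
  x^2.\<close>

lemma weighted_integrable:
  assumes f: "integrable M f"
  shows "integrable (M \<Otimes>\<^sub>M M) (\<lambda>(t, z). k t z * f z)"
proof (rule integrableI_bounded)
  have [measurable]: "f \<in> borel_measurable M" using f by auto
  show "(\<lambda>(t, z). k t z * f z) \<in> borel_measurable (M \<Otimes>\<^sub>M M)" by measurable
  have "(\<integral>\<^sup>+p. norm (case p of (t, z) \<Rightarrow> k t z * f z) \<partial>(M \<Otimes>\<^sub>M M))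
      = (\<integral>\<^sup>+z. (\<integral>\<^sup>+t. ennreal \<bar>f z\<bar> * ennreal (k t z) \<partial>M) \<partial>M)"
    by (subst P.nn_integral_snd[symmetric])
      (auto simp: abs_mult nonneg ennreal_mult mult.commute)
  also have "\<dots> = (\<integral>\<^sup>+z. ennreal \<bar>f z\<bar> * (\<integral>\<^sup>+t. k t z \<partial>M) \<partial>M)"
    by (intro nn_integral_cong nn_integral_cmult) measurable
  also have "\<dots> \<le> (\<integral>\<^sup>+z. ennreal \<bar>f z\<bar> * ennreal S \<partial>M)"
    by (intro nn_integral_mono mult_left_mono col) auto
  also have "\<dots> = (\<integral>\<^sup>+z. ennreal \<bar>f z\<bar> \<partial>M) * ennreal S" by (rule nn_integral_multc) measurable
  also have "\<dots> < \<infinity>"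
    using f by (auto simp: integrable_iff_bounded ennreal_mult_less_top)
  finally show "(\<integral>\<^sup>+p. norm (case p of (t, z) \<Rightarrow> k t z * f z) \<partial>(M \<Otimes>\<^sub>M M)) < \<infinity>" .
qed

lemma weighted_integral_le:
  assumes f: "integrable M f" and f0: "\<And>z. 0 \<le> f z"
  shows "(\<integral>t. (\<integral>z. k t z * f z \<partial>M) \<partial>M) \<le> S * (\<integral>z. f z \<partial>M)"
proof -
  interpret tr: schur_kernel M "\<lambda>t z. k z t" S by (rule transpose)
  have "(\<integral>t. (\<integral>z. k t z * f z \<partial>M) \<partial>M) = (\<integral>z. (\<integral>t. k t z * f z \<partial>M) \<partial>M)"
    using P.Fubini_integral[OF weighted_integrable[OF f]] by simp
  also have "\<dots> = (\<integral>z. (\<integral>t. k t z \<partial>M) * f z \<partial>M)" by simp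
  also have "\<dots> \<le> (\<integral>z. S * f z \<partial>M)"
  proof (rule integral_mono)
    show "integrable M (\<lambda>z. (\<integral>t. k t z \<partial>M) * f z)"
      using P.integrable_snd[OF weighted_integrable[OF f]] by simp
    show "(\<integral>t. k t z \<partial>M) * f z \<le> S * f z" if "z \<in> space M" for z
      using tr.row_integrable[OF that] f0 by (intro mult_right_mono)
  qed (use f in simp)
  finally show ?thesis by simp
qed

text \<open>Since the absolute value of \<open>x\<close> is at most 1 + x^2, the integrand is
  dominated by k + k x^2. The first summand is integrable by the row bound, the second for almost
  every \<open>t\<close> by Fubini.\<close>

lemma AE_integrable:
  assumes x: "square_integrable M x"
  shows "AE t in M. integrable M (\<lambda>z. k t z * x z)"
  using P.AE_integrable_fst[OF weighted_integrable[OF square_integrable_power2[OF x]]] AE_space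
proof eventually_elim
  case (elim t)
  have [measurable]: "x \<in> borel_measurable M" using x by (rule square_integrable_measurable)
  have t[measurable]: "t \<in> space M" by fact
  show ?case
  proof (rule Bochner_Integration.integrable_bound)
    show "integrable M (\<lambda>z. k t z * 1 + k t z * (x z)\<^sup>2)"
      using elim row_integrable(1)[OF t] by simp
    have "\<bar>x z\<bar> \<le> 1 + (x z)\<^sup>2" for z
      using abs_mult_le_sum_squares[of "x z" 1] by simp
    then show "AE z in M. norm (k t z * x z) \<le> norm (k t z * 1 + k t z * (x z)\<^sup>2)"
      by (intro AE_I2) (simp add: abs_mult nonneg mult_left_mono flip: distrib_left del: mult_1_right)
  qed measurable
qed

lemma kernel_op_measurable [measurable]:
  assumes [measurable]: "x \<in> borel_measurable M"
  shows "kernel_op M k x \<in> borel_measurable M"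
  unfolding kernel_op_def[abs_def] by measurable

text \<open>The Cauchy--Schwarz inequality for the measure \<open>k t z dz\<close>, whose mass is at most \<open>S\<close>:
  expand the second moment about \<open>kernel_op M k x t / S\<close>.\<close>

lemma kernel_op_power2_le:
  assumes x: "square_integrable M x"
  shows "AE t in M. (kernel_op M k x t)\<^sup>2 \<le> S * (\<integral>z. k t z * (x z)\<^sup>2 \<partial>M)"
  using P.AE_integrable_fst[OF weighted_integrable[OF square_integrable_power2[OF x]]]
    AE_integrable[OF x] AE_space
proof eventually_elim
  case (elim t)
  note r = row_integrable[OF elim(3)]
  let ?I = "kernel_op M k x t" and ?Q = "\<integral>z. k t z * (x z)\<^sup>2 \<partial>M"
  define m where "m = ?I / S"
  have "0 \<le> (\<integral>z. k t z * (x z - m)\<^sup>2 \<partial>M)" using nonneg by simp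
  also have "\<dots> = (\<integral>z. k t z * (x z)\<^sup>2 - 2 * m * (k t z * x z) + m\<^sup>2 * k t z \<partial>M)"
    by (rule Bochner_Integration.integral_cong) (auto simp: power2_eq_square algebra_simps)
  also have "\<dots> = ?Q - 2 * m * ?I + m\<^sup>2 * (\<integral>z. k t z \<partial>M)"
    unfolding kernel_op_def using elim r(1) by simp
  also have "\<dots> \<le> ?Q - 2 * m * ?I + m\<^sup>2 * S"
    using r(2) by (intro add_left_mono mult_left_mono) auto
  also have "\<dots> = ?Q - ?I\<^sup>2 / S"
    using S_pos by (simp add: m_def power2_eq_square field_simps)
  finally show ?case using S_pos by (simp add: field_simps)
qed

text \<open>The Schur test: one factor \<open>S\<close> comes from the rows through
  \<open>kernel_op_power2_le\<close>, the other from the columns through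
  \<open>weighted_integral_le\<close>.\<close>

lemma square_integrable_kernel_op:
  assumes x: "square_integrable M x"
  shows "square_integrable M (kernel_op M k x)"
    and "(\<integral>t. (kernel_op M k x t)\<^sup>2 \<partial>M) \<le> S\<^sup>2 * (\<integral>t. (x t)\<^sup>2 \<partial>M)"
proof -
  note x2 = square_integrable_power2[OF x]
  have [measurable]: "x \<in> borel_measurable M" using x by (rule square_integrable_measurable)
  note int = integrable_mult_right[OF P.integrable_fst[OF weighted_integrable[OF x2]], of S]
  have int': "integrable M (\<lambda>t. (kernel_op M k x t)\<^sup>2)"
  proof (rule Bochner_Integration.integrable_bound[OF int])
    show "AE t in M. norm ((kernel_op M k x t)\<^sup>2) \<le> norm (S * (\<integral>z. k t z * (x z)\<^sup>2 \<partial>M))"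
      using kernel_op_power2_le[OF x]
    proof eventually_elim
      case (elim t)
      have "0 \<le> (kernel_op M k x t)\<^sup>2" by simp
      with elim show ?case by simp
    qed
  qed measurable
  then show "square_integrable M (kernel_op M k x)" by (simp add: square_integrable_def)
  have "(\<integral>t. (kernel_op M k x t)\<^sup>2 \<partial>M) \<le> (\<integral>t. S * (\<integral>z. k t z * (x z)\<^sup>2 \<partial>M) \<partial>M)"
    using int' int kernel_op_power2_le[OF x] by (rule integral_mono_AE)
  also have "\<dots> \<le> S * (S * (\<integral>t. (x t)\<^sup>2 \<partial>M))"
    using weighted_integral_le[OF x2] S_pos by simp
  finally show "(\<integral>t. (kernel_op M k x t)\<^sup>2 \<partial>M) \<le> S\<^sup>2 * (\<integral>t. (x t)\<^sup>2 \<partial>M)"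
    by (simp add: power2_eq_square mult.assoc)
qed

lemma kernel_op_linear:
  assumes x: "square_integrable M x" and y: "square_integrable M y"
  shows "AE t in M. kernel_op M k (\<lambda>z. a * x z + b * y z) t = a * kernel_op M k x t + b * kernel_op M k y t"
  using AE_integrable[OF x] AE_integrable[OF y]
proof eventually_elim
  case (elim t)
  have "kernel_op M k (\<lambda>z. a * x z + b * y z) t = (\<integral>z. a * (k t z * x z) + b * (k t z * y z) \<partial>M)"
    unfolding kernel_op_def by (simp add: algebra_simps)
  then show ?case using elim by (simp add: kernel_op_def)
qed

text \<open>Lets an almost everywhere identity for an inner operator pass through an outer one, at
  every point \<open>t\<close> of the space.\<close>

lemma kernel_op_cong_AE:
  assumes "t \<in> space M" "AE z in M. x z = y z" and [measurable]: "x \<in> borel_measurable M" "y \<in> borel_measurable M"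
  shows "kernel_op M k x t = kernel_op M k y t"
proof -
  note [measurable] = assms(1)
  show ?thesis unfolding kernel_op_def using assms(2) by (intro integral_cong_AE) auto
qed

text \<open>Fubini, with k t z * ((x z)^2 + (y t)^2) as the integrable majorant.\<close>

lemma kernel_op_adjoint:
  assumes x: "square_integrable M x" and y: "square_integrable M y"
  shows "(\<integral>t. kernel_op M k x t * y t \<partial>M) = (\<integral>t. x t * kernel_op M (\<lambda>t z. k z t) y t \<partial>M)"
proof -
  interpret tr: schur_kernel M "\<lambda>t z. k z t" S by (rule transpose)
  have [measurable]: "x \<in> borel_measurable M" "y \<in> borel_measurable M"
    using x y by (auto intro: square_integrable_measurable)
  have "integrable (M \<Otimes>\<^sub>M M) (\<lambda>(t, z). k t z * x z * y t)"
  proof (rule Bochner_Integration.integrable_bound)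
    have "integrable (M \<Otimes>\<^sub>M M) (\<lambda>(t, z). k t z * (y t)\<^sup>2)"
      using P.integrable_product_swap[OF tr.weighted_integrable[OF square_integrable_power2[OF y]]]
      by (simp add: case_prod_beta)
    then show "integrable (M \<Otimes>\<^sub>M M) (\<lambda>p. (case p of (t, z) \<Rightarrow> k t z * (x z)\<^sup>2) + (case p of (t, z) \<Rightarrow> k t z * (y t)\<^sup>2))"
      by (intro Bochner_Integration.integrable_add weighted_integrable square_integrable_power2 x)
    show "AE p in M \<Otimes>\<^sub>M M. norm (case p of (t, z) \<Rightarrow> k t z * x z * y t)
        \<le> norm ((case p of (t, z) \<Rightarrow> k t z * (x z)\<^sup>2) + (case p of (t, z) \<Rightarrow> k t z * (y t)\<^sup>2))"
      using abs_mult_le_sum_squares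
      by (intro AE_I2) (auto simp: abs_mult nonneg mult.assoc mult_left_mono simp flip: distrib_left)
  qed measurable
  from P.Fubini_integral[OF this]
  have "(\<integral>t. (\<integral>z. k t z * x z * y t \<partial>M) \<partial>M) = (\<integral>z. (\<integral>t. k t z * x z * y t \<partial>M) \<partial>M)" by simp
  moreover have "(\<integral>z. k t z * x z * y t \<partial>M) = kernel_op M k x t * y t" for t
    by (simp add: kernel_op_def)
  moreover have "(\<integral>t. k t z * x z * y t \<partial>M) = x z * kernel_op M (\<lambda>t z. k z t) y z" for z
    unfolding kernel_op_def integral_mult_right_zero[symmetric]
    by (rule Bochner_Integration.integral_cong) (auto simp: mult_ac)
  ultimately show ?thesis by (simp only:)
qed

text \<open>By adjointness the quadratic form is \<open>c\<close> times the integral of the square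
  of \<open>kernel_op M k x\<close>. The summand 1 keeps the bound positive even for c = 0.\<close>

lemma gram_positive:
  assumes c: "0 \<le> c"
  shows "positive_L2_operator M (\<lambda>x t. c * kernel_op M (\<lambda>t z. k z t) (kernel_op M k x) t) (c\<^sup>2 * S\<^sup>2 * S\<^sup>2 + 1)"
proof -
  interpret tr: schur_kernel M "\<lambda>t z. k z t" S by (rule transpose)
  note sq = square_integrable_kernel_op and tsq = tr.square_integrable_kernel_op
  let ?K = "kernel_op M k" and ?T = "kernel_op M (\<lambda>t z. k z t)"
  show ?thesis
  proof
    fix x assume x: "square_integrable M x"
    note Kx = sq(1)[OF x] and TKx = tsq(1)[OF sq(1)[OF x]]
    show "square_integrable M (\<lambda>t. c * ?T (?K x) t)"
      using TKx by (rule square_integrable_cmult)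
    have "(\<integral>t. (c * ?T (?K x) t)\<^sup>2 \<partial>M) = c\<^sup>2 * (\<integral>t. (?T (?K x) t)\<^sup>2 \<partial>M)"
      by (simp add: power_mult_distrib)
    also have "\<dots> \<le> c\<^sup>2 * (S\<^sup>2 * (S\<^sup>2 * (\<integral>t. (x t)\<^sup>2 \<partial>M)))"
      using order_trans[OF tsq(2)[OF Kx] mult_left_mono[OF sq(2)[OF x]]] by (intro mult_left_mono) auto
    also have "\<dots> \<le> (c\<^sup>2 * S\<^sup>2 * S\<^sup>2 + 1) * (\<integral>t. (x t)\<^sup>2 \<partial>M)"
      by (simp add: algebra_simps)
    finally show "(\<integral>t. (c * ?T (?K x) t)\<^sup>2 \<partial>M) \<le> (c\<^sup>2 * S\<^sup>2 * S\<^sup>2 + 1) * (\<integral>t. (x t)\<^sup>2 \<partial>M)" .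
    have "(\<integral>t. x t * (c * ?T (?K x) t) \<partial>M) = c * (\<integral>t. x t * ?T (?K x) t \<partial>M)"
      by (simp add: mult.left_commute[of _ c])
    also have "\<dots> = c * (\<integral>t. ?K x t * ?K x t \<partial>M)"
      using kernel_op_adjoint[OF x Kx] by simp
    finally show "0 \<le> (\<integral>t. x t * (c * ?T (?K x) t) \<partial>M)" using c by simp
    fix y a b assume y: "square_integrable M y"
    note Ky = sq(1)[OF y]
    note [measurable] = x[THEN square_integrable_measurable] y[THEN square_integrable_measurable]
    show "AE t in M. c * ?T (?K (\<lambda>s. a * x s + b * y s)) t = a * (c * ?T (?K x) t) + b * (c * ?T (?K y) t)"
      using tr.kernel_op_linear[OF Kx Ky, of a b] AE_space
    proof eventually_elim
      case (elim t)
      have "?T (?K (\<lambda>s. a * x s + b * y s)) t = ?T (\<lambda>s. a * ?K x s + b * ?K y s) t"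
        using elim(2) kernel_op_linear[OF x y] by (rule tr.kernel_op_cong_AE) measurable
      with elim(1) show ?case by (simp add: algebra_simps)
    qed
  qed (simp add: add_nonneg_pos)
qed

text \<open>Exchanges the order of integration in the composed operator. Fubini is justified by
  applying \<open>AE_integrable\<close> for the transposed kernel to the image of the absolute value
  of \<open>x\<close>.\<close>

lemma gram_kernel:
  assumes x: "square_integrable M x"
  shows "AE t in M. integrable M (\<lambda>z. (\<integral>u. k u t * k u z \<partial>M) * x z) \<and>
    (\<integral>z. (\<integral>u. k u t * k u z \<partial>M) * x z \<partial>M) = kernel_op M (\<lambda>t z. k z t) (kernel_op M k x) t"
proof -
  interpret tr: schur_kernel M "\<lambda>t z. k z t" S by (rule transpose)
  note [measurable] = x[THEN square_integrable_measurable]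
  show ?thesis
    using tr.AE_integrable[OF square_integrable_kernel_op(1)[OF square_integrable_abs[OF x]]] AE_space
  proof eventually_elim
    case (elim t)
    note [measurable] = \<open>t \<in> space M\<close>
    have int: "integrable (M \<Otimes>\<^sub>M M) (\<lambda>(u, z). k u t * (k u z * x z))"
    proof (rule P.Fubini_integrable)
      show "integrable M (\<lambda>u. \<integral>z. norm (case (u, z) of (u, z) \<Rightarrow> k u t * (k u z * x z)) \<partial>M)"
        using elim(1) by (simp add: kernel_op_def abs_mult nonneg)
      show "AE u in M. integrable M (\<lambda>z. case (u, z) of (u, z) \<Rightarrow> k u t * (k u z * x z))"
        using AE_integrable[OF x] by eventually_elim simp
    qed measurable
    have eq: "(\<integral>u. k u t * k u z \<partial>M) * x z = (\<integral>u. k u t * (k u z * x z) \<partial>M)" for z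
      by (simp flip: integral_mult_left_zero add: mult.assoc)
    show ?case
      unfolding eq using P.integrable_snd[OF int] P.Fubini_integral[OF int] by (simp add: kernel_op_def)
  qed
qed

end

subsection \<open>The Riemann--Liouville kernel\<close>

text \<open>For \<alpha> < 1 the integrand blows up at an endpoint, but its antiderivative is
  continuous on the closed interval, so differentiability in the interior suffices. Nonnegativity
  turns the gauge integral into \<open>nn_integral\<close>.\<close>

lemma nn_integral_powr_shift:
  fixes a b \<alpha> :: real
  assumes ab: "a \<le> b" and \<alpha>: "0 < \<alpha>"
  shows nn_integral_powr_left:
      "(\<integral>\<^sup>+z. ennreal (indicator {a..b} z * (z - a) powr (\<alpha> - 1)) \<partial>lebesgue) = ennreal ((b - a) powr \<alpha> / \<alpha>)"
    and nn_integral_powr_right: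
      "(\<integral>\<^sup>+z. ennreal (indicator {a..b} z * (b - z) powr (\<alpha> - 1)) \<partial>lebesgue) = ennreal ((b - a) powr \<alpha> / \<alpha>)"
proof -
  have to_nn: "(\<integral>\<^sup>+z. ennreal (indicator {a..b} z * f z) \<partial>lebesgue) = ennreal r"
    if "(f has_integral r) {a..b}" "\<And>z. 0 \<le> f z" for f r
  proof -
    have "((\<lambda>z. indicator {a..b} z * f z) has_integral r) UNIV"
      using that(1) by (subst (asm) has_integral_restrict_UNIV[symmetric])
        (simp add: indicator_def of_bool_def if_distrib[of "\<lambda>c. c * _"] cong: if_cong)
    then show ?thesis
      using that(2) by (subst (asm) has_integral_iff_nn_integral_lebesgue) auto
  qed
  have "((\<lambda>z. (z - a) powr (\<alpha> - 1)) has_integral ((b - a) powr \<alpha> / \<alpha> - (a - a) powr \<alpha> / \<alpha>)) {a..b}"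
  proof (rule fundamental_theorem_of_calculus_interior[OF ab])
    show "continuous_on {a..b} (\<lambda>z. (z - a) powr \<alpha> / \<alpha>)"
      using \<alpha> by (intro continuous_on_divide continuous_on_minus continuous_on_powr' continuous_intros) auto
    fix x assume "x \<in> {a<..<b}"
    then show "((\<lambda>z. (z - a) powr \<alpha> / \<alpha>) has_vector_derivative (x - a) powr (\<alpha> - 1)) (at x)"
      using \<alpha> unfolding has_real_derivative_iff_has_vector_derivative[symmetric]
      by (auto intro!: derivative_eq_intros)
  qed
  then have "((\<lambda>z. (z - a) powr (\<alpha> - 1)) has_integral ((b - a) powr \<alpha> / \<alpha>)) {a..b}"
    by simp
  then show "(\<integral>\<^sup>+z. ennreal (indicator {a..b} z * (z - a) powr (\<alpha> - 1)) \<partial>lebesgue) = ennreal ((b - a) powr \<alpha> / \<alpha>)"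
    by (rule to_nn) simp
  have "((\<lambda>z. (b - z) powr (\<alpha> - 1)) has_integral (- ((b - b) powr \<alpha> / \<alpha>) - - ((b - a) powr \<alpha> / \<alpha>))) {a..b}"
  proof (rule fundamental_theorem_of_calculus_interior[OF ab])
    show "continuous_on {a..b} (\<lambda>z. - ((b - z) powr \<alpha> / \<alpha>))"
      using \<alpha> by (intro continuous_on_divide continuous_on_minus continuous_on_powr' continuous_intros) auto
    fix x assume "x \<in> {a<..<b}"
    then show "((\<lambda>z. - ((b - z) powr \<alpha> / \<alpha>)) has_vector_derivative (b - x) powr (\<alpha> - 1)) (at x)"
      using \<alpha> unfolding has_real_derivative_iff_has_vector_derivative[symmetric]
      by (auto intro!: derivative_eq_intros)
  qed
  then have "((\<lambda>z. (b - z) powr (\<alpha> - 1)) has_integral ((b - a) powr \<alpha> / \<alpha>)) {a..b}"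
    by simp
  then show "(\<integral>\<^sup>+z. ennreal (indicator {a..b} z * (b - z) powr (\<alpha> - 1)) \<partial>lebesgue) = ennreal ((b - a) powr \<alpha> / \<alpha>)"
    by (rule to_nn) simp
qed

lemma set_integrable_powr_left:
  fixes a b \<alpha> :: real
  assumes "a \<le> b" "0 < \<alpha>"
  shows "set_integrable lebesgue {a..b} (\<lambda>z. (z - a) powr (\<alpha> - 1))"
proof -
  show ?thesis unfolding set_integrable_def real_scaleR_def
  proof (rule integrableI_nn_integral_finite[OF _ _ nn_integral_powr_left[OF assms]])
    show "(\<lambda>z. indicat_real {a..b} z * (z - a) powr (\<alpha> - 1)) \<in> borel_measurable lebesgue"
      by (rule measurable_completion) measurable
  qed simp
qed

text \<open>Moves variable limits of integration into an indicator over one fixed measure space,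
  where they become part of the kernel.\<close>

lemma integral_subset_lebesgue_on:
  fixes f :: "real \<Rightarrow> real"
  assumes "A \<subseteq> B" "A \<in> sets lebesgue" "B \<in> sets lebesgue"
  shows set_integrable_iff_lebesgue_on:
      "set_integrable lebesgue A f \<longleftrightarrow> integrable (lebesgue_on B) (\<lambda>z. indicator A z * f z)"
    and set_lebesgue_integral_eq_lebesgue_on:
      "(LINT z:A|lebesgue. f z) = (\<integral>z. indicator A z * f z \<partial>lebesgue_on B)"
proof -
  have *: "indicat_real B z *\<^sub>R (indicator A z * f z) = indicator A z *\<^sub>R f z" for z
    using assms(1) by (auto simp: indicator_def)
  have B: "B \<inter> space lebesgue \<in> sets lebesgue" using assms(3) by simp
  show "set_integrable lebesgue A f \<longleftrightarrow> integrable (lebesgue_on B) (\<lambda>z. indicator A z * f z)"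
    unfolding integrable_restrict_space[OF B] set_integrable_def * ..
  show "(LINT z:A|lebesgue. f z) = (\<integral>z. indicator A z * f z \<partial>lebesgue_on B)"
    unfolding integral_restrict_space[OF B] set_lebesgue_integral_def * ..
qed

text \<open>The factor 1 / Gamma \<alpha> is left out and collected in \<open>C2\<close> later. As
  \<open>0 powr a = 0\<close>, the kernel vanishes on the diagonal and at t = 0.\<close>

definition rl_kernel :: "real \<Rightarrow> real \<Rightarrow> real \<Rightarrow> real" where
  "rl_kernel \<alpha> t z = of_bool (z \<le> t) * (t powr (- \<alpha>) * (t - z) powr (\<alpha> - 1) * z powr \<alpha>)"

lemma rl_kernel_nonneg: "0 \<le> rl_kernel \<alpha> t z"
  by (simp add: rl_kernel_def)

text \<open>The weights contribute (z / t)^\<alpha>, which is at most 1 for z \<le> t; for t = 0 the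
  kernel is 0.\<close>

lemma rl_kernel_le:
  assumes "0 \<le> z" "0 < \<alpha>"
  shows "rl_kernel \<alpha> t z \<le> of_bool (z \<le> t) * (t - z) powr (\<alpha> - 1)"
proof (cases "z \<le> t \<and> 0 < t")
  case True
  have "t powr (- \<alpha>) * z powr \<alpha> \<le> t powr (- \<alpha>) * t powr \<alpha>"
    using True assms by (intro mult_left_mono powr_mono2) auto
  also have "\<dots> = 1" using True by (simp add: powr_minus)
  finally have "t powr (- \<alpha>) * z powr \<alpha> * (t - z) powr (\<alpha> - 1) \<le> 1 * (t - z) powr (\<alpha> - 1)"
    by (rule mult_right_mono) simp
  then show ?thesis using True by (simp add: rl_kernel_def mult_ac)
next
  case False
  then have "t < z \<or> t = 0" using assms by auto
  then show ?thesis by (auto simp: rl_kernel_def)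
qed

text \<open>Without the weights, the row at \<open>t\<close> has mass t^\<alpha> / \<alpha> and the
  column at \<open>t\<close> has mass (T - t)^\<alpha> / \<alpha>.\<close>

lemma rl_kernel_schur:
  assumes \<alpha>: "0 < \<alpha>" and T: "0 < T"
  shows "schur_kernel (lebesgue_on {0..T}) (rl_kernel \<alpha>) (T powr \<alpha> / \<alpha>)"
proof -
  let ?M = "lebesgue_on {0..T}"
  have M: "{0..T} \<inter> space lebesgue \<in> sets lebesgue" by simp
  interpret finite_measure ?M by (rule finite_measure_lebesgue_on) simp
  have [measurable]: "(\<lambda>z. z) \<in> borel_measurable ?M"
    using id_borel_measurable_lebesgue_on by (simp add: id_def)
  show ?thesis
  proof
    have [measurable]: "fst \<in> borel_measurable (?M \<Otimes>\<^sub>M ?M)" "snd \<in> borel_measurable (?M \<Otimes>\<^sub>M ?M)"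
      using measurable_compose[OF measurable_fst, of "\<lambda>z. z" ?M borel ?M]
        measurable_compose[OF measurable_snd, of "\<lambda>z. z" ?M borel ?M] by simp_all
    \<comment> \<open>The formula is Borel in both variables; the coordinate map out of the product
      of Lebesgue spaces transports this.\<close>
    have [measurable]: "(\<lambda>(t, z). rl_kernel \<alpha> t z) \<in> borel_measurable (borel \<Otimes>\<^sub>M borel)"
      unfolding rl_kernel_def by measurable
    have "(\<lambda>p. (fst p, snd p)) \<in> ?M \<Otimes>\<^sub>M ?M \<rightarrow>\<^sub>M borel \<Otimes>\<^sub>M borel" by measurable
    from measurable_compose[OF this, of "\<lambda>(t, z). rl_kernel \<alpha> t z" borel]
    show "case_prod (rl_kernel \<alpha>) \<in> borel_measurable (?M \<Otimes>\<^sub>M ?M)" by (simp add: case_prod_beta')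
    fix t assume "t \<in> space ?M"
    then have t: "0 \<le> t" "t \<le> T" by auto
    have "(\<integral>\<^sup>+z. rl_kernel \<alpha> t z \<partial>?M) \<le> (\<integral>\<^sup>+z. ennreal (indicator {0..t} z * (t - z) powr (\<alpha> - 1)) \<partial>lebesgue)"
      unfolding nn_integral_restrict_space[OF M]
    proof (rule nn_integral_mono)
      fix z
      show "ennreal (rl_kernel \<alpha> t z) * indicator {0..T} z \<le> ennreal (indicator {0..t} z * (t - z) powr (\<alpha> - 1))"
        using rl_kernel_le[of z \<alpha> t] \<alpha> by (auto simp: indicator_def rl_kernel_def)
    qed
    also have "\<dots> = ennreal ((t - 0) powr \<alpha> / \<alpha>)" using t \<alpha> by (intro nn_integral_powr_right)
    also have "\<dots> \<le> ennreal (T powr \<alpha> / \<alpha>)"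
      using t \<alpha> by (intro ennreal_leI divide_right_mono powr_mono2) auto
    finally show "(\<integral>\<^sup>+z. rl_kernel \<alpha> t z \<partial>?M) \<le> ennreal (T powr \<alpha> / \<alpha>)" .
    have "(\<integral>\<^sup>+z. rl_kernel \<alpha> z t \<partial>?M) \<le> (\<integral>\<^sup>+z. ennreal (indicator {t..T} z * (z - t) powr (\<alpha> - 1)) \<partial>lebesgue)"
      unfolding nn_integral_restrict_space[OF M]
    proof (rule nn_integral_mono)
      fix z
      show "ennreal (rl_kernel \<alpha> z t) * indicator {0..T} z \<le> ennreal (indicator {t..T} z * (z - t) powr (\<alpha> - 1))"
        using rl_kernel_le[of t \<alpha> z] t \<alpha> by (auto simp: indicator_def rl_kernel_def)
    qed
    also have "\<dots> = ennreal ((T - t) powr \<alpha> / \<alpha>)" using t \<alpha> by (intro nn_integral_powr_left)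
    also have "\<dots> \<le> ennreal (T powr \<alpha> / \<alpha>)"
      using t \<alpha> by (intro ennreal_leI divide_right_mono powr_mono2) auto
    finally show "(\<integral>\<^sup>+z. rl_kernel \<alpha> z t \<partial>?M) \<le> ennreal (T powr \<alpha> / \<alpha>)" .
  qed (use \<alpha> T in \<open>auto simp: rl_kernel_nonneg\<close>)
qed

lemma L2_iff: "x \<in> L2 T \<longleftrightarrow> square_integrable (lebesgue_on {0..T}) x"
  by (simp add: L2_def square_integrable_def)

lemma RL_right_cong:
  assumes "\<And>u. u \<in> {t..T} \<Longrightarrow> f u = g u"
  shows "RL_right T a f t = RL_right T a g t"
    and "RL_right_exists T a f t = RL_right_exists T a g t"
proof -
  show "RL_right T a f t = RL_right T a g t"
    unfolding RL_right_def using assms by (intro arg_cong2[of _ _ _ _ "(*)"] set_lebesgue_integral_cong) auto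
  show "RL_right_exists T a f t = RL_right_exists T a g t"
    unfolding RL_right_exists_def using assms by (intro set_integrable_cong) auto
qed

lemma AE_lebesgue_on_neq:
  assumes "S \<in> sets lebesgue"
  shows "AE z in lebesgue_on S. z \<noteq> t"
proof -
  have "AE z in lebesgue. z \<noteq> t" by (rule AE_completion) (rule AE_lborel_singleton)
  then show ?thesis using assms by (subst AE_restrict_space_iff) auto
qed

lemma kappa_integrand_commute: "kappa_integrand H z t = kappa_integrand H t z"
  by (auto simp: kappa_integrand_def mult_ac)

section \<open>Both sides of the three equations in terms of one Gram operator\<close>

context
  fixes H T :: real
  assumes H: "0 < H" "H < 1/2" and T: "0 < T"
begin

private abbreviation "\<alpha> \<equiv> 1/2 - H"
private abbreviation "M \<equiv> lebesgue_on {0..T}"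
private abbreviation "K \<equiv> kernel_op M (rl_kernel \<alpha>)"
private abbreviation "K' \<equiv> kernel_op M (\<lambda>t z. rl_kernel \<alpha> z t)"

interpretation rl: schur_kernel M "rl_kernel \<alpha>" "T powr \<alpha> / \<alpha>"
  using H T by (intro rl_kernel_schur) auto

interpretation rlt: schur_kernel M "\<lambda>t z. rl_kernel \<alpha> z t" "T powr \<alpha> / \<alpha>"
  by (rule rl.transpose)

interpretation gram: positive_L2_operator M "\<lambda>x t. C2 H * K' (K x) t"
  "(C2 H)\<^sup>2 * (T powr \<alpha> / \<alpha>)\<^sup>2 * (T powr \<alpha> / \<alpha>)\<^sup>2 + 1"
  by (rule rl.gram_positive) (simp add: C2_def power_int_def)

lemma RL_left_integrand:
  assumes "0 \<le> z"
  shows "t powr (- \<alpha>) * (indicator {0..t} z * ((t - z) powr (\<alpha> - 1) * (z powr \<alpha> * x z)))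
    = rl_kernel \<alpha> t z * x z"
  using assms by (simp add: rl_kernel_def indicator_def)

lemma RL_right_integrand:
  assumes "z \<le> T"
  shows "t powr \<alpha> * (indicator {t..T} z * ((z - t) powr (\<alpha> - 1) * (z powr (- \<alpha>) * x z)))
    = rl_kernel \<alpha> z t * x z"
  using assms by (simp add: rl_kernel_def indicator_def)

text \<open>Valid for every function \<open>x\<close> and up to t = 0: constants enter an integral
  even when it diverges, and at t = 0 both sides vanish.\<close>

lemma RL_left_eq:
  assumes t: "t \<in> {0..T}"
  shows "t powr (- \<alpha>) * RL_left \<alpha> (\<lambda>z. z powr \<alpha> * x z) t = K x t / Gamma \<alpha>"
proof -
  have "t powr (- \<alpha>) * (LINT z:{0..t}|lebesgue. (t - z) powr (\<alpha> - 1) * (z powr \<alpha> * x z)) = K x t"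
  proof -
    have sub: "{0..t} \<subseteq> {0..T}" "{0..t} \<in> sets lebesgue" "{0..T} \<in> sets lebesgue" using t by auto
    show ?thesis
      unfolding set_lebesgue_integral_eq_lebesgue_on[OF sub] integral_mult_right_zero[symmetric] kernel_op_def
      by (intro Bochner_Integration.integral_cong refl RL_left_integrand) simp
  qed
  then show ?thesis by (simp add: RL_left_def mult.left_commute[of "t powr _"])
qed

lemma RL_right_eq:
  assumes t: "t \<in> {0..T}"
  shows "t powr \<alpha> * RL_right T \<alpha> (\<lambda>z. z powr (- \<alpha>) * x z) t = K' x t / Gamma \<alpha>"
proof -
  have "t powr \<alpha> * (LINT z:{t..T}|lebesgue. (z - t) powr (\<alpha> - 1) * (z powr (- \<alpha>) * x z)) = K' x t"
  proof -
    have sub: "{t..T} \<subseteq> {0..T}" "{t..T} \<in> sets lebesgue" "{0..T} \<in> sets lebesgue" using t by auto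
    show ?thesis
      unfolding set_lebesgue_integral_eq_lebesgue_on[OF sub] integral_mult_right_zero[symmetric] kernel_op_def
      by (intro Bochner_Integration.integral_cong refl RL_right_integrand) simp
  qed
  then show ?thesis by (simp add: RL_right_def mult.left_commute[of "t powr _"])
qed

text \<open>The point t = 0 is left out because the weight is 0 there and cannot be
  cancelled.\<close>

lemma RL_left_exists_iff:
  assumes t: "t \<in> {0<..T}"
  shows "RL_left_exists \<alpha> (\<lambda>z. z powr \<alpha> * x z) t \<longleftrightarrow> integrable M (\<lambda>z. rl_kernel \<alpha> t z * x z)"
proof -
  have "RL_left_exists \<alpha> (\<lambda>z. z powr \<alpha> * x z) t \<longleftrightarrow>
      integrable M (\<lambda>z. t powr (- \<alpha>) * (indicator {0..t} z * ((t - z) powr (\<alpha> - 1) * (z powr \<alpha> * x z))))"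
    unfolding RL_left_exists_def using t
    by (subst set_integrable_iff_lebesgue_on[of _ "{0..T}"]) auto
  also have "\<dots> \<longleftrightarrow> integrable M (\<lambda>z. rl_kernel \<alpha> t z * x z)"
    by (intro Bochner_Integration.integrable_cong refl RL_left_integrand) simp
  finally show ?thesis .
qed

lemma RL_right_exists_iff:
  assumes t: "t \<in> {0<..T}"
  shows "RL_right_exists T \<alpha> (\<lambda>z. z powr (- \<alpha>) * x z) t \<longleftrightarrow> integrable M (\<lambda>z. rl_kernel \<alpha> z t * x z)"
proof -
  have "RL_right_exists T \<alpha> (\<lambda>z. z powr (- \<alpha>) * x z) t \<longleftrightarrow>
      integrable M (\<lambda>z. t powr \<alpha> * (indicator {t..T} z * ((z - t) powr (\<alpha> - 1) * (z powr (- \<alpha>) * x z))))"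
    unfolding RL_right_exists_def using t
    by (subst set_integrable_iff_lebesgue_on[of _ "{0..T}"]) auto
  also have "\<dots> \<longleftrightarrow> integrable M (\<lambda>z. rl_kernel \<alpha> z t * x z)"
    by (intro Bochner_Integration.integrable_cong refl RL_right_integrand) simp
  finally show ?thesis .
qed

lemma K0_star_eq:
  assumes "t \<in> {0..T}"
  shows "K0_star H x t = inverse (C1 H) / Gamma \<alpha> * K x t"
  using arg_cong[OF RL_left_eq[OF assms, of x], of "(*) (inverse (C1 H))"]
  by (simp add: K0_star_def mult.assoc)

text \<open>As 2 * H - 1 = -2 \<alpha>, the power splits into two equal weights: one completes the
  left integral to \<open>K\<close>, the other belongs to \<open>K'\<close>.\<close>

lemma RL_left_weighted_eq:
  assumes "u \<in> {0..T}"
  shows "u powr (2 * H - 1) * RL_left \<alpha> (\<lambda>z. z powr \<alpha> * x z) u = u powr (- \<alpha>) * (1 / Gamma \<alpha> * K x u)"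
proof -
  have "u powr (2 * H - 1) = u powr (- \<alpha>) * u powr (- \<alpha>)"
    by (simp flip: powr_add)
  then show ?thesis
    using arg_cong[OF RL_left_eq[OF assms, of x], of "(*) (u powr (- \<alpha>))"] by (simp add: mult.assoc)
qed

text \<open>Each fractional integral contributes 1 / Gamma \<alpha>; with
  \<open>C1 H powi (-2)\<close> they make up \<open>C2 H\<close>.\<close>

lemma RL_side_eq_gram:
  assumes t: "t \<in> {0..T}"
  shows "C1 H powi (-2) * t powr \<alpha> * RL_right T \<alpha>
      (\<lambda>u. u powr (2 * H - 1) * RL_left \<alpha> (\<lambda>z. z powr \<alpha> * x z) u) t = C2 H * K' (K x) t"
proof -
  have "t powr \<alpha> * RL_right T \<alpha> (\<lambda>u. u powr (2 * H - 1) * RL_left \<alpha> (\<lambda>z. z powr \<alpha> * x z) u) t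
      = t powr \<alpha> * RL_right T \<alpha> (\<lambda>u. u powr (- \<alpha>) * (1 / Gamma \<alpha> * K x u)) t"
    using t by (subst RL_right_cong(1)[OF RL_left_weighted_eq]) auto
  also have "\<dots> = 1 / Gamma \<alpha> * K' (K x) t / Gamma \<alpha>"
    unfolding RL_right_eq[OF t] kernel_op_cmult ..
  finally show ?thesis by (simp add: C2_def power2_eq_square mult.assoc)
qed

lemma KT_K0_eq_gram:
  assumes t: "t \<in> {0..T}"
  shows "KT_star T H (K0_star H x) t = C2 H * K' (K x) t"
proof -
  have "KT_star T H (K0_star H x) t = inverse (C1 H) * (t powr \<alpha> * RL_right T \<alpha> (\<lambda>u. u powr (- \<alpha>) * K0_star H x u) t)"
    by (simp add: KT_star_def)
  also have "RL_right T \<alpha> (\<lambda>u. u powr (- \<alpha>) * K0_star H x u) t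
      = RL_right T \<alpha> (\<lambda>u. u powr (- \<alpha>) * (inverse (C1 H) / Gamma \<alpha> * K x u)) t"
    using t by (intro RL_right_cong(1)) (simp add: K0_star_eq)
  also have "t powr \<alpha> * \<dots> = inverse (C1 H) / Gamma \<alpha> * K' (K x) t / Gamma \<alpha>"
    unfolding RL_right_eq[OF t] kernel_op_cmult ..
  finally show ?thesis by (simp add: C2_def power2_eq_square power_int_def field_simps)
qed

text \<open>Only the factor in u - t is singular, with exponent \<alpha> - 1 > -1. The other two
  decrease in \<open>u\<close> and are bounded by their values at u = t, where t > z \<ge>
  0.\<close>

lemma kappa_integrand_integrable:
  assumes "0 \<le> z" "z < t" "t \<le> T"
  shows "set_integrable lebesgue {t..T} (kappa_integrand H z t)"
proof -
  let ?c = "t powr (2 * H - 1) * (t - z) powr (-1/2 - H)"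
  have "set_integrable lebesgue {t..T} (\<lambda>u. ?c * (u - t) powr (\<alpha> - 1))"
    using assms H by (intro set_integrable_mult_right set_integrable_powr_left) auto
  then show ?thesis
    unfolding set_integrable_def
  proof (rule Bochner_Integration.integrable_bound)
    show "(\<lambda>u. indicat_real {t..T} u *\<^sub>R kappa_integrand H z t u) \<in> borel_measurable lebesgue"
      unfolding kappa_integrand_def
      by (rule measurable_completion) measurable
    have "kappa_integrand H z t u \<le> ?c * (u - t) powr (\<alpha> - 1)" if "t \<le> u" for u
    proof -
      have "u powr (2 * H - 1) * (u - z) powr (-1/2 - H) \<le> ?c"
        using assms H that by (intro mult_mono powr_mono2') auto
      from mult_right_mono[OF this, of "(u - t) powr (\<alpha> - 1)"] show ?thesis
        by (simp add: kappa_integrand_def mult_ac)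
    qed
    then show "AE u in lebesgue. norm (indicat_real {t..T} u *\<^sub>R kappa_integrand H z t u)
        \<le> norm (indicat_real {t..T} u *\<^sub>R (?c * (u - t) powr (\<alpha> - 1)))"
      by (intro AE_I2) (auto simp: indicator_def kappa_integrand_def)
  qed
qed

text \<open>Both kernels vanish unless \<open>u\<close> exceeds max z t, which unifies the two cases
  of \<open>kappa\<close>. The factor \<open>of_bool\<close> is there because \<open>kappa\<close>
  is 0 on the diagonal by definition.\<close>

lemma kappa_eq_gram:
  assumes t: "t \<in> {0..T}" and z: "z \<in> {0..T}"
  shows "kappa H T z t = of_bool (z \<noteq> t) * (\<integral>u. rl_kernel \<alpha> u t * rl_kernel \<alpha> u z \<partial>M)"
proof -
  let ?m = "max z t"
  have "(\<integral>u. rl_kernel \<alpha> u t * rl_kernel \<alpha> u z \<partial>M)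
      = (\<integral>u. (t * z) powr \<alpha> * (indicator {?m..T} u * kappa_integrand H z t u) \<partial>M)"
  proof (rule Bochner_Integration.integral_cong[OF refl])
    fix u assume "u \<in> space M"
    then have "u \<le> T" by simp
    moreover have "u powr (2 * H - 1) = u powr (- \<alpha>) * u powr (- \<alpha>)"
      by (simp flip: powr_add)
    ultimately show "rl_kernel \<alpha> u t * rl_kernel \<alpha> u z = (t * z) powr \<alpha> * (indicator {?m..T} u * kappa_integrand H z t u)"
      using t z by (auto simp: rl_kernel_def kappa_integrand_def indicator_def powr_mult)
  qed
  also have "\<dots> = (t * z) powr \<alpha> * (LINT u:{?m..T}|lebesgue. kappa_integrand H z t u)"
    using t z by (subst set_lebesgue_integral_eq_lebesgue_on[of _ "{0..T}"]) auto
  finally show ?thesis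
    using t z by (auto simp: kappa_def max_def)
qed

lemma kernel_side_eq_gram:
  assumes x: "square_integrable M x"
  shows "AE t in M. set_integrable lebesgue {0..T} (\<lambda>z. kappa H T z t * x z) \<and>
    (LINT z:{0..T}|lebesgue. kappa H T z t * x z) = K' (K x) t"
  using rl.gram_kernel[OF x] AE_space
proof eventually_elim
  case (elim t)
  let ?g = "\<lambda>z. (\<integral>u. rl_kernel \<alpha> u t * rl_kernel \<alpha> u z \<partial>M) * x z"
  have t: "t \<in> {0..T}" using elim by simp
  have [measurable]: "?g \<in> borel_measurable M" using elim by auto
  have [measurable]: "(\<lambda>z. z) \<in> borel_measurable M"
    using id_borel_measurable_lebesgue_on by (simp add: id_def)
  have eq: "indicator {0..T} z * (kappa H T z t * x z) = of_bool (z \<noteq> t) * ?g z" if "z \<in> space M" for z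
    using that t by (simp add: kappa_eq_gram)
  let ?f = "\<lambda>z. indicator {0..T} z * (kappa H T z t * x z)"
  have f: "?f \<in> borel_measurable M" by (subst measurable_cong[OF eq]) measurable
  \<comment> \<open>The diagonal is met at the single point z = t, a null set.\<close>
  have ae: "AE z in M. ?f z = ?g z"
    using AE_lebesgue_on_neq[of "{0..T}" t, simplified] AE_space by eventually_elim (subst eq, auto)
  have "integrable M ?f \<longleftrightarrow> integrable M ?g" using f _ ae by (rule integrable_cong_AE) measurable
  moreover have "(\<integral>z. ?f z \<partial>M) = (\<integral>z. ?g z \<partial>M)" using f _ ae by (rule integral_cong_AE) measurable
  ultimately show ?case
    using elim
      set_integrable_iff_lebesgue_on[of "{0..T}" "{0..T}"] set_lebesgue_integral_eq_lebesgue_on[of "{0..T}" "{0..T}"]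
    by simp
qed

section \<open>Equivalence, unique solvability and existence of the integrals\<close>

private abbreviation "gram_eq g x \<equiv> AE t in M. x t + C2 H * K' (K x) t = g t"

lemma solves_K_iff: "solves_K_eq H T g x \<longleftrightarrow> gram_eq g x"
  unfolding solves_K_eq_def by (intro AE_cong) (simp add: KT_K0_eq_gram add.commute)

lemma solves_RL_iff: "solves_RL_eq H T g x \<longleftrightarrow> gram_eq g x"
  unfolding solves_RL_eq_def by (intro AE_cong) (simp add: RL_side_eq_gram add.commute del: diff_divide_distrib)

text \<open>Unlike the pointwise identities behind the other two equations, this one comes from
  Fubini: \<open>x\<close> is taken square integrable and the identity holds for almost every
  \<open>t\<close>.\<close>

lemma solves_kernel_iff:
  assumes "square_integrable M x"
  shows "solves_kernel_eq H T g x \<longleftrightarrow> gram_eq g x"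
proof -
  have "AE t in M. (x t + C2 H * (LINT z:{0..T}|lebesgue. kappa H T z t * x z) = g t)
      \<longleftrightarrow> x t + C2 H * K' (K x) t = g t"
    using kernel_side_eq_gram[OF assms] by eventually_elim simp
  then show ?thesis unfolding solves_kernel_eq_def by (rule eventually_subst)
qed

lemma unique_gram_solution:
  assumes g: "square_integrable M g" and P: "\<And>x. square_integrable M x \<Longrightarrow> P x \<longleftrightarrow> gram_eq g x"
  shows "has_unique_L2_solution T P"
proof -
  obtain x where x: "square_integrable M x" "gram_eq g x" using gram.solution_exists[OF g] .
  then show ?thesis
    unfolding has_unique_L2_solution_def L2_iff using P gram.solution_unique[of x]
    by (intro bexI[of _ x]) (auto simp: L2_iff)
qed

text \<open>The Schur bound is applied to \<open>x\<close> for the left integral and to multiples of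
  \<open>K x\<close> for the right ones.\<close>

lemma all_integrals_exist:
  assumes x: "square_integrable M x"
  shows "integrals_exist H T x"
  unfolding integrals_exist_def
proof (intro conjI ballI impI)
  fix z t :: real
  assume "z \<in> {0..T}" "t \<in> {0..T}" "z \<noteq> t"
  then show "set_integrable lebesgue {max z t..T} (kappa_integrand H z t)"
    using kappa_integrand_integrable[of z t] kappa_integrand_integrable[of t z] kappa_integrand_commute[of H z t]
    by (cases "z < t") (auto simp: max_def)
next
  show "AE t in M. set_integrable lebesgue {0..T} (\<lambda>z. kappa H T z t * x z)"
    using kernel_side_eq_gram[OF x] by eventually_elim simp
  have pos: "AE t in M. t \<in> {0<..T}" using AE_lebesgue_on_neq[of "{0..T}" 0, simplified] AE_space by eventually_elim auto
  show "AE t in M. RL_left_exists \<alpha> (\<lambda>z. z powr \<alpha> * x z) t"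
    using rl.AE_integrable[OF x] pos by eventually_elim (simp only: RL_left_exists_iff)
  \<comment> \<open>The constant \<open>c\<close> stays free because the two right integrals carry
    different multiples of \<open>K x\<close>.\<close>
  have int: "AE t in M. integrable M (\<lambda>z. rl_kernel \<alpha> z t * (c * K x z))" for c
    using rl.square_integrable_kernel_op(1)[OF x] by (intro rlt.AE_integrable square_integrable_cmult)
  show "AE t in M. RL_right_exists T \<alpha> (\<lambda>u. u powr (2 * H - 1) * RL_left \<alpha> (\<lambda>z. z powr \<alpha> * x z) u) t"
    using int[of "1 / Gamma \<alpha>"] pos
  proof eventually_elim
    case (elim t)
    then show ?case by (subst RL_right_cong(2)[OF RL_left_weighted_eq]) (auto simp only: RL_right_exists_iff, auto)
  qed
  show "AE t in M. RL_right_exists T \<alpha> (\<lambda>u. u powr (H - 1/2) * K0_star H x u) t"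
    using int[of "inverse (C1 H) / Gamma \<alpha>"] pos
  proof eventually_elim
    case (elim t)
    have "u powr (H - 1/2) * K0_star H x u = u powr (- \<alpha>) * (inverse (C1 H) / Gamma \<alpha> * K x u)"
      if "u \<in> {t..T}" for u
      using that elim by (simp add: K0_star_eq)
    from RL_right_cong(2)[OF this] elim show ?case by (simp only: RL_right_exists_iff)
  qed
qed

end

theorem theorem3p7:
  fixes H T :: real and g' :: "real \<Rightarrow> real"
  assumes "0 < H" and "H < 1/2" and "0 < T" and "g' \<in> L2 T"
  shows "has_unique_L2_solution T (solves_kernel_eq H T g') \<and>
         has_unique_L2_solution T (solves_RL_eq H T g') \<and>
         has_unique_L2_solution T (solves_K_eq H T g') \<and>
         (\<forall>x\<in>L2 T. (solves_kernel_eq H T g' x \<longleftrightarrow> solves_RL_eq H T g' x) \<and>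
                    (solves_RL_eq H T g' x \<longleftrightarrow> solves_K_eq H T g' x)) \<and>
         (\<forall>x\<in>L2 T. integrals_exist H T x)"
proof -
  note H = assms(1-3)
  have g: "square_integrable (lebesgue_on {0..T}) g'" using assms(4) L2_iff by simp
  show ?thesis
    using unique_gram_solution[OF H g] solves_kernel_iff[OF H] solves_RL_iff[OF H] solves_K_iff[OF H]
      all_integrals_exist[OF H]
    by (auto simp: L2_iff)
qed

end
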